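(* Let $(X,d)$ be a metric space and $0<\beta\le\alpha\le 1$. If $X$ is connected and there exists an RKHS $H$ over $X$ with $$\mathrm{H\ddot{o}l}^{\alpha}_{d}(X)\hookrightarrow H\hookrightarrow \mathrm{H\ddot{o}l}^{\beta}_{d}(X),$$ then there exists a constant $C>0$ such that for all $0<\delta<\min\{1,\operatorname{diam}X\}$ we have $$N^{\mathrm{pack}}_{d}(X,\delta)\le C\,\delta^{-2(\alpha-\beta)}.$$ Moreover, if there exists an RKHS $H$ over $X$ such that $$\mathrm{H\ddot{o}l}^{\alpha}_{d}(X)\hookrightarrow H\hookrightarrow \ell_\infty(X),$$ then there exists a constant $C>0$ such that for all $0<\delta<\min\{1,\operatorname{diam}X\}$ we have $$N^{\mathrm{pack}}_{d}(X,\delta)\le C\,\delta^{-2\alpha}.$$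
   Context: For a (nonempty) metric space $(X,d)$ and $\alpha\in(0,1]$, the space $\mathrm{H\ddot{o}l}^{\alpha}_d(X)$ consists of all $f:X\to\mathbb{R}$ with finite norm $\|f\|_{\mathrm{H\ddot{o}l}^\alpha_d}:=\max\bigl\{\sup_{x\neq y\in X}\frac{|f(x)-f(y)|}{d^\alpha(x,y)},\ \sup_{x\in X}|f(x)|\bigr\}$. $\ell_\infty(X)$ is the space of all bounded functions $X\to\mathbb{R}$ with the supremum norm. $\operatorname{diam}X:=\sup_{s,t\in X}d(s,t)$. For $\delta>0$, points $x_1,\dots,x_n\in X$ form a $\delta$-packing if $d(x_i,x_j)\ge\delta$ for all $i\ne j$, and $N^{\mathrm{pack}}_d(X,\delta):=\sup\{n\in\mathbb{N}: \text{there exists a }\delta\text{-packing }x_1,\dots,x_n\in X\}$. A reproducing kernel Hilbert space (RKHS) over $X$ is a Hilbert space whose elements are functions $X\to\mathbb{R}$ and for which all evaluation functionals $f\mapsto f(x)$, $x\in X$, are continuous. $E\hookrightarrow H$ means that $E\subset H$ (as sets of functions) and the inclusion map is continuous. *)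

theory Defs
  imports "HOL-Analysis.Analysis"
begin

text \<open>
  The metric space \<open>X\<close> is a type of class \<^class>\<open>metric_space\<close>, so functions on \<open>X\<close> are total and
  \<open>X\<close> is nonempty. Suprema that may be infinite are taken in \<^typ>\<open>ereal\<close> or \<^typ>\<open>enat\<close>; in
  particular \<^const>\<open>diameter\<close> is not used, as it is unspecified for unbounded sets.
\<close>

definition ediameter :: "'a::metric_space set \<Rightarrow> ereal" where
  "ediameter X = (SUP (s, t) \<in> X \<times> X. ereal (dist s t))"

definition is_packing :: "'a::metric_space set \<Rightarrow> real \<Rightarrow> nat \<Rightarrow> (nat \<Rightarrow> 'a) \<Rightarrow> bool" where
  "is_packing X \<delta> n x \<longleftrightarrow>
     (\<forall>i<n. x i \<in> X) \<and> (\<forall>i<n. \<forall>j<n. i \<noteq> j \<longrightarrow> \<delta> \<le> dist (x i) (x j))"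

definition packing_number :: "'a::metric_space set \<Rightarrow> real \<Rightarrow> enat" where
  "packing_number X \<delta> = (SUP n \<in> {n. \<exists>x. is_packing X \<delta> n x}. enat n)"

text \<open>A normed space of functions is given by its carrier and a norm on that carrier; the vector
  space operations are pointwise. The locale \<^locale>\<open>Metric_space\<close> requires nonnegativity and
  symmetry of the distance also off the carrier, so the induced distance is set to \<open>0\<close> there.\<close>

definition fun_norm_dist ::
    "('a \<Rightarrow> real) set \<Rightarrow> (('a \<Rightarrow> real) \<Rightarrow> real) \<Rightarrow> ('a \<Rightarrow> real) \<Rightarrow> ('a \<Rightarrow> real) \<Rightarrow> real" where
  "fun_norm_dist E N f g = (if f \<in> E \<and> g \<in> E then N (\<lambda>x. f x - g x) else 0)"

definition fun_norm_topology ::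
    "('a \<Rightarrow> real) set \<Rightarrow> (('a \<Rightarrow> real) \<Rightarrow> real) \<Rightarrow> ('a \<Rightarrow> real) topology" where
  "fun_norm_topology E N = Metric_space.mtopology E (fun_norm_dist E N)"

definition continuously_embedded ::
    "('a \<Rightarrow> real) set \<Rightarrow> (('a \<Rightarrow> real) \<Rightarrow> real) \<Rightarrow>
     ('a \<Rightarrow> real) set \<Rightarrow> (('a \<Rightarrow> real) \<Rightarrow> real) \<Rightarrow> bool" where
  "continuously_embedded E N\<^sub>E F N\<^sub>F \<longleftrightarrow>
     E \<subseteq> F \<and> continuous_map (fun_norm_topology E N\<^sub>E) (fun_norm_topology F N\<^sub>F) (\<lambda>f. f)"

definition hoelder_enorm :: "real \<Rightarrow> ('a::metric_space \<Rightarrow> real) \<Rightarrow> ereal" where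
  "hoelder_enorm \<alpha> f =
     max (SUP (x, y) \<in> {(x, y). x \<noteq> y}. ereal (\<bar>f x - f y\<bar> / dist x y powr \<alpha>))
         (SUP x. ereal \<bar>f x\<bar>)"

definition hoelder_space :: "real \<Rightarrow> ('a::metric_space \<Rightarrow> real) set" where
  "hoelder_space \<alpha> = {f. hoelder_enorm \<alpha> f < \<infinity>}"

definition hoelder_norm :: "real \<Rightarrow> ('a::metric_space \<Rightarrow> real) \<Rightarrow> real" where
  "hoelder_norm \<alpha> f = real_of_ereal (hoelder_enorm \<alpha> f)"

definition linf_space :: "('a \<Rightarrow> real) set" where
  "linf_space = {f. bounded (range f)}"

definition linf_norm :: "('a \<Rightarrow> real) \<Rightarrow> real" where
  "linf_norm f = (SUP x. \<bar>f x\<bar>)"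

definition ip_norm :: "(('a \<Rightarrow> real) \<Rightarrow> ('a \<Rightarrow> real) \<Rightarrow> real) \<Rightarrow> ('a \<Rightarrow> real) \<Rightarrow> real" where
  "ip_norm ip f = sqrt (ip f f)"

text \<open>Only the values of \<open>ip\<close> on \<open>H\<close> matter.\<close>

locale rkhs =
  fixes H :: "('a \<Rightarrow> real) set"
    and ip :: "('a \<Rightarrow> real) \<Rightarrow> ('a \<Rightarrow> real) \<Rightarrow> real"
  assumes zero_mem: "(\<lambda>x. 0) \<in> H"
    and add_mem: "f \<in> H \<Longrightarrow> g \<in> H \<Longrightarrow> (\<lambda>x. f x + g x) \<in> H"
    and scale_mem: "f \<in> H \<Longrightarrow> (\<lambda>x. c * f x) \<in> H"
    and ip_commute: "f \<in> H \<Longrightarrow> g \<in> H \<Longrightarrow> ip f g = ip g f"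
    and ip_add_left: "f \<in> H \<Longrightarrow> g \<in> H \<Longrightarrow> h \<in> H \<Longrightarrow> ip (\<lambda>x. f x + g x) h = ip f h + ip g h"
    and ip_scale_left: "f \<in> H \<Longrightarrow> g \<in> H \<Longrightarrow> ip (\<lambda>x. c * f x) g = c * ip f g"
    and ip_nonneg: "f \<in> H \<Longrightarrow> 0 \<le> ip f f"
    and ip_definite: "f \<in> H \<Longrightarrow> ip f f = 0 \<Longrightarrow> f = (\<lambda>x. 0)"
    and complete: "Metric_space.mcomplete H (fun_norm_dist H (ip_norm ip))"
    and eval_continuous:
      "continuous_map (fun_norm_topology H (ip_norm ip)) euclideanreal (\<lambda>f. f x)"

end

theory Submission
  imports Defs
begin

text \<open>
  Both bounds come from comparing two estimates for signed sums of bumps. A \<open>\<delta>\<close>-packing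
  \<open>x\<^sub>1, \<dots>, x\<^sub>n\<close> carries the tents \<open>v\<^sub>i\<close> of height \<open>1\<close> over the open balls of radius \<open>\<delta>/2\<close>. These
  balls are disjoint, so for every choice of signs the sum \<open>\<Sum> \<epsilon>\<^sub>i v\<^sub>i\<close> is no worse than two tents:
  its \<open>\<alpha>\<close>-Hoelder norm is at most \<open>4 \<delta>\<^sup>-\<^sup>\<alpha>\<close>, uniformly in \<open>n\<close>
  (\<open>hoelder_signed_tent_sum\<close>). The first embedding turns this into
  \<open>\<parallel>\<Sum> \<epsilon>\<^sub>i v\<^sub>i\<parallel>\<^sub>H \<le> 4 C\<^sub>1 \<delta>\<^sup>-\<^sup>\<alpha>\<close>.

  In an inner product space, on the other hand, the signs can be chosen with
  \<open>\<Sum> \<parallel>v\<^sub>i\<parallel>\<^sup>2 \<le> \<parallel>\<Sum> \<epsilon>\<^sub>i v\<^sub>i\<parallel>\<^sup>2\<close> (\<open>rkhs.exists_signs\<close>), and the second embedding bounds every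
  \<open>\<parallel>v\<^sub>i\<parallel>\<^sub>H\<close> from below. For \<open>\<ell>\<^sub>\<infinity>\<close> the bound is \<open>1 / C\<^sub>2\<close>, because \<open>v\<^sub>i\<close> has height \<open>1\<close>. For the
  \<open>\<beta>\<close>-Hoelder space it is \<open>\<delta>\<^sup>-\<^sup>\<beta> / C\<^sub>2\<close>, because \<open>v\<^sub>i\<close> drops from \<open>1\<close> to \<open>0\<close> over the distance
  \<open>\<delta>/2\<close>; connectedness is what provides a point at exactly that distance from \<open>x\<^sub>i\<close>
  (\<open>connected_point_at_distance\<close>). With \<open>\<gamma> = 0\<close> and \<open>\<gamma> = \<beta>\<close> respectively, both cases read
  \<open>n (\<delta>\<^sup>-\<^sup>\<gamma> / C\<^sub>2)\<^sup>2 \<le> (4 C\<^sub>1 \<delta>\<^sup>-\<^sup>\<alpha>)\<^sup>2\<close>, which is the claim (\<open>packing_bound\<close>).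

  The continuity of the embeddings enters through their operator bounds \<open>C\<^sub>1\<close>, \<open>C\<^sub>2\<close>, which exist
  since a linear map that is continuous at \<open>0\<close> is bounded (\<open>continuously_embedded_bound\<close>).
\<close>

section \<open>Normed spaces of functions\<close>

locale normed_fun_space =
  fixes E :: "('a \<Rightarrow> real) set" and N :: "('a \<Rightarrow> real) \<Rightarrow> real"
  assumes zero_mem: "(\<lambda>x. 0) \<in> E"
    and add_mem: "f \<in> E \<Longrightarrow> g \<in> E \<Longrightarrow> (\<lambda>x. f x + g x) \<in> E"
    and scale_mem: "f \<in> E \<Longrightarrow> (\<lambda>x. c * f x) \<in> E"
    and norm_add: "f \<in> E \<Longrightarrow> g \<in> E \<Longrightarrow> N (\<lambda>x. f x + g x) \<le> N f + N g"
    and norm_scale: "f \<in> E \<Longrightarrow> N (\<lambda>x. c * f x) = \<bar>c\<bar> * N f"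
    and norm_definite: "f \<in> E \<Longrightarrow> N f = 0 \<Longrightarrow> f = (\<lambda>x. 0)"
begin

lemma norm_zero: "N (\<lambda>x. 0) = 0"
  using norm_scale[OF zero_mem, of 0] by simp

lemma norm_nonneg:
  assumes "f \<in> E"
  shows "0 \<le> N f"
  using norm_add[OF assms scale_mem[OF assms, of "-1"]] norm_scale[OF assms, of "-1"] norm_zero
  by simp

lemma diff_mem: "f \<in> E \<Longrightarrow> g \<in> E \<Longrightarrow> (\<lambda>x. f x - g x) \<in> E"
  using add_mem[OF _ scale_mem[of g "-1"], of f] by simp

lemma metric_space: "Metric_space E (fun_norm_dist E N)"
proof
  fix f g h
  show "0 \<le> fun_norm_dist E N f g"
    by (simp add: fun_norm_dist_def norm_nonneg diff_mem)
  show "fun_norm_dist E N f g = fun_norm_dist E N g f"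
    using norm_scale[OF diff_mem, of f g "-1"] by (simp add: fun_norm_dist_def)
  assume fg: "f \<in> E" "g \<in> E"
  show "fun_norm_dist E N f g = 0 \<longleftrightarrow> f = g"
    using norm_definite[OF diff_mem[OF fg]] fg norm_zero
    by (auto simp: fun_norm_dist_def fun_eq_iff)
  assume h: "h \<in> E"
  show "fun_norm_dist E N f h \<le> fun_norm_dist E N f g + fun_norm_dist E N g h"
    using norm_add[OF diff_mem[OF fg] diff_mem[OF fg(2) h]] fg h by (simp add: fun_norm_dist_def)
qed

end

text \<open>
  By continuity at \<open>0\<close>, some ball around \<open>0\<close> in \<open>E\<close> lies in the unit ball of \<open>F\<close>, and every
  nonzero \<open>f \<in> E\<close> can be rescaled into that ball.
\<close>

lemma continuously_embedded_bound:
  assumes "normed_fun_space E N\<^sub>E" and "normed_fun_space F N\<^sub>F"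
    and emb: "continuously_embedded E N\<^sub>E F N\<^sub>F"
  shows "\<exists>C>0. \<forall>f\<in>E. N\<^sub>F f \<le> C * N\<^sub>E f"
proof -
  interpret E: normed_fun_space E N\<^sub>E by fact
  interpret F: normed_fun_space F N\<^sub>F by fact
  interpret ME: Metric_space E "fun_norm_dist E N\<^sub>E" by (rule E.metric_space)
  interpret MF: Metric_space F "fun_norm_dist F N\<^sub>F" by (rule F.metric_space)
  have sub: "E \<subseteq> F" and cont: "continuous_map ME.mtopology MF.mtopology (\<lambda>f. f)"
    using emb by (auto simp: continuously_embedded_def fun_norm_topology_def)
  let ?U = "{f \<in> topspace ME.mtopology. f \<in> MF.mball (\<lambda>x. 0) 1}"
  have "openin ME.mtopology ?U"
    using cont MF.openin_mball by (rule openin_continuous_map_preimage)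
  moreover have "(\<lambda>x. 0) \<in> ?U"
    using E.zero_mem F.zero_mem by simp
  ultimately obtain r where r: "r > 0" "ME.mball (\<lambda>x. 0) r \<subseteq> ?U"
    unfolding ME.openin_mtopology by blast
  have small: "N\<^sub>F g < 1" if g: "g \<in> E" "N\<^sub>E g < r" for g
  proof -
    have "fun_norm_dist E N\<^sub>E (\<lambda>x. 0) g < r"
      using g E.norm_scale[OF g(1), of "-1"] E.zero_mem by (simp add: fun_norm_dist_def)
    then have "g \<in> MF.mball (\<lambda>x. 0) 1"
      using r(2) g E.zero_mem by auto
    then show ?thesis
      using F.norm_scale[of g "-1"] by (auto simp: fun_norm_dist_def)
  qed
  have "N\<^sub>F f \<le> 2 / r * N\<^sub>E f" if f: "f \<in> E" for f
  proof (cases "N\<^sub>E f = 0")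
    case True
    then show ?thesis
      using E.norm_definite[OF f] F.norm_zero by simp
  next
    case False
    then have pos: "N\<^sub>E f > 0"
      using E.norm_nonneg[OF f] by simp
    let ?c = "r / (2 * N\<^sub>E f)"
    have "N\<^sub>E (\<lambda>x. ?c * f x) < r"
      using r(1) pos E.norm_scale[OF f, of ?c] by simp
    then have "?c * N\<^sub>F f < 1"
      using small[OF E.scale_mem[OF f], of ?c] F.norm_scale[of f ?c] f sub r(1) pos
      by (auto simp del: times_divide_eq_left)
    then show ?thesis
      using r(1) pos by (simp add: field_simps)
  qed
  then show ?thesis
    using r(1) by (intro exI[of _ "2 / r"]) simp
qed

section \<open>Inner product spaces of functions\<close>

context rkhs
begin

lemma ip_add_right:
  "f \<in> H \<Longrightarrow> g \<in> H \<Longrightarrow> h \<in> H \<Longrightarrow> ip h (\<lambda>x. f x + g x) = ip h f + ip h g"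
  using ip_commute[of h] ip_add_left[of f g h] add_mem[of f g] by simp

lemma ip_scale_right: "f \<in> H \<Longrightarrow> g \<in> H \<Longrightarrow> ip g (\<lambda>x. c * f x) = c * ip g f"
  using ip_commute[of g] ip_scale_left[of f g c] scale_mem[of f c] by simp

lemma ip_self_add_scale:
  assumes "f \<in> H" "g \<in> H"
  shows "ip (\<lambda>x. f x + c * g x) (\<lambda>x. f x + c * g x) = ip f f + 2 * c * ip f g + c\<^sup>2 * ip g g"
  using assms ip_commute[of f g]
  by (simp add: ip_add_left ip_add_right ip_scale_left ip_scale_right add_mem scale_mem
      algebra_simps power2_eq_square)

lemma Cauchy_Schwarz:
  assumes f: "f \<in> H" and g: "g \<in> H"
  shows "(ip f g)\<^sup>2 \<le> ip f f * ip g g"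
proof (cases "ip g g = 0")
  case True
  then have "g = (\<lambda>x. 0 * f x)"
    using ip_definite[OF g] by simp
  then have "ip f g = 0"
    using ip_scale_right[OF f f, of 0] by simp
  then show ?thesis
    using True by simp
next
  case False
  then have pos: "ip g g > 0"
    using ip_nonneg[OF g] by simp
  \<comment> \<open>The coefficient of \<open>g\<close> minimises the squared norm, a quadratic polynomial in it.\<close>
  have "0 \<le> ip f f + 2 * (- ip f g / ip g g) * ip f g + (- ip f g / ip g g)\<^sup>2 * ip g g"
    using ip_nonneg[OF add_mem[OF f scale_mem[OF g]]] ip_self_add_scale[OF f g] by metis
  also have "\<dots> = ip f f - (ip f g)\<^sup>2 / ip g g"
    using pos by (simp add: power2_eq_square field_simps)
  finally show ?thesis
    using pos by (simp add: field_simps)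
qed

lemma ip_norm_square: "f \<in> H \<Longrightarrow> (ip_norm ip f)\<^sup>2 = ip f f"
  by (simp add: ip_norm_def ip_nonneg)

lemma normed_fun_space: "normed_fun_space H (ip_norm ip)"
proof
  show "(\<lambda>x. 0) \<in> H" by (rule zero_mem)
next
  fix f g assume f: "f \<in> H" and g: "g \<in> H"
  show "(\<lambda>x. f x + g x) \<in> H" using f g by (rule add_mem)
  have "ip f g \<le> sqrt (ip f f * ip g g)"
    using Cauchy_Schwarz[OF f g] by (rule real_le_rsqrt)
  then have "ip f f + 2 * ip f g + ip g g \<le> (ip_norm ip f + ip_norm ip g)\<^sup>2"
    using ip_norm_square[OF f] ip_norm_square[OF g]
    by (simp add: power2_sum) (simp add: ip_norm_def real_sqrt_mult)
  then show "ip_norm ip (\<lambda>x. f x + g x) \<le> ip_norm ip f + ip_norm ip g"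
    using ip_self_add_scale[OF f g, of 1] ip_nonneg[OF f] ip_nonneg[OF g]
    by (auto intro!: real_le_lsqrt simp: ip_norm_def)
next
  fix f c assume f: "f \<in> H"
  show "(\<lambda>x. c * f x) \<in> H" using f by (rule scale_mem)
  show "ip_norm ip (\<lambda>x. c * f x) = \<bar>c\<bar> * ip_norm ip f"
    using f by (simp add: ip_norm_def ip_scale_left ip_scale_right scale_mem real_sqrt_mult
        flip: mult.assoc power2_eq_square)
  show "f = (\<lambda>x. 0)" if "ip_norm ip f = 0"
    using ip_definite[OF f] that by (simp add: ip_norm_def)
qed

text \<open>
  Adding the vectors one at a time, the sign of the next one is chosen so that its inner product
  with the sum so far is nonnegative; the squared norm then grows at least by its squared norm.
\<close>

lemma exists_signs:
  fixes v :: "nat \<Rightarrow> 'a \<Rightarrow> real"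
  assumes "\<And>i. i < n \<Longrightarrow> v i \<in> H"
  shows "\<exists>s. (\<forall>i. \<bar>s i\<bar> = 1) \<and> (\<lambda>x. \<Sum>i<n. s i * v i x) \<in> H \<and>
    (\<Sum>i<n. ip (v i) (v i)) \<le> ip (\<lambda>x. \<Sum>i<n. s i * v i x) (\<lambda>x. \<Sum>i<n. s i * v i x)"
  using assms
proof (induction n)
  case 0
  show ?case
    by (rule exI[of _ "\<lambda>_. 1"]) (simp add: zero_mem ip_nonneg)
next
  case (Suc n)
  from Suc.IH[OF Suc.prems[OF less_SucI]]
  obtain s where s: "\<forall>i. \<bar>s i\<bar> = 1" and mem: "(\<lambda>x. \<Sum>i<n. s i * v i x) \<in> H"
    and le: "(\<Sum>i<n. ip (v i) (v i)) \<le> ip (\<lambda>x. \<Sum>i<n. s i * v i x) (\<lambda>x. \<Sum>i<n. s i * v i x)"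
    by blast
  define w where "w = (\<lambda>x. \<Sum>i<n. s i * v i x)"
  have vn: "v n \<in> H" and w: "w \<in> H"
    using Suc.prems mem by (auto simp: w_def)
  define c :: real where "c = (if 0 \<le> ip w (v n) then 1 else - 1)"
  have c: "\<bar>c\<bar> = 1" "c\<^sup>2 = 1" "0 \<le> c * ip w (v n)"
    by (auto simp: c_def)
  have sum_eq: "(\<Sum>i<Suc n. (s(n := c)) i * v i x) = w x + c * v n x" for x
    by (simp add: w_def)
  have "(\<Sum>i<Suc n. ip (v i) (v i)) \<le> ip w w + ip (v n) (v n)"
    using le by (simp add: w_def)
  also have "\<dots> \<le> ip (\<lambda>x. w x + c * v n x) (\<lambda>x. w x + c * v n x)"
    using ip_self_add_scale[OF w vn, of c] c by simp
  finally have "(\<Sum>i<Suc n. ip (v i) (v i)) \<le>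
    ip (\<lambda>x. \<Sum>i<Suc n. (s(n := c)) i * v i x) (\<lambda>x. \<Sum>i<Suc n. (s(n := c)) i * v i x)"
    unfolding sum_eq .
  moreover have "(\<lambda>x. \<Sum>i<Suc n. (s(n := c)) i * v i x) \<in> H"
    unfolding sum_eq using w vn by (intro add_mem scale_mem)
  moreover have "\<forall>i. \<bar>(s(n := c)) i\<bar> = 1"
    using s c by simp
  ultimately show ?case
    by blast
qed

end

section \<open>Hoelder functions and bounded functions\<close>

lemma hoelder_enorm_le_iff:
  fixes f :: "'a::metric_space \<Rightarrow> real"
  shows "hoelder_enorm \<alpha> f \<le> ereal K \<longleftrightarrow>
    (\<forall>x y. \<bar>f x - f y\<bar> \<le> K * dist x y powr \<alpha>) \<and> (\<forall>x. \<bar>f x\<bar> \<le> K)"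
proof -
  have "\<bar>f x - f y\<bar> / dist x y powr \<alpha> \<le> K \<longleftrightarrow> \<bar>f x - f y\<bar> \<le> K * dist x y powr \<alpha>"
    if "x \<noteq> y" for x y
    using that by (simp add: pos_divide_le_eq)
  then have "hoelder_enorm \<alpha> f \<le> ereal K \<longleftrightarrow>
      (\<forall>x y. x \<noteq> y \<longrightarrow> \<bar>f x - f y\<bar> \<le> K * dist x y powr \<alpha>) \<and> (\<forall>x. \<bar>f x\<bar> \<le> K)"
    by (auto simp: hoelder_enorm_def SUP_le_iff)
  also have "\<dots> \<longleftrightarrow> (\<forall>x y. \<bar>f x - f y\<bar> \<le> K * dist x y powr \<alpha>) \<and> (\<forall>x. \<bar>f x\<bar> \<le> K)"
    by (metis abs_zero diff_self dist_self mult_zero_right order_refl powr_0)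
  finally show ?thesis .
qed

lemma hoelder_enorm_nonneg: "0 \<le> hoelder_enorm \<alpha> f"
proof -
  have "0 \<le> ereal \<bar>f undefined\<bar>"
    by simp
  also have "\<dots> \<le> (SUP x. ereal \<bar>f x\<bar>)"
    by (rule SUP_upper) simp
  finally show ?thesis
    by (simp add: hoelder_enorm_def le_max_iff_disj)
qed

lemma hoelder_enorm_eq_norm:
  assumes "f \<in> hoelder_space \<alpha>"
  shows "hoelder_enorm \<alpha> f = ereal (hoelder_norm \<alpha> f)"
  using assms hoelder_enorm_nonneg[of \<alpha> f]
  by (auto simp: hoelder_space_def hoelder_norm_def ereal_real)

lemma hoelder_normI:
  assumes "\<And>x y. \<bar>f x - f y\<bar> \<le> K * dist x y powr \<alpha>" and "\<And>x. \<bar>f x\<bar> \<le> K"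
  shows "f \<in> hoelder_space \<alpha>" and "hoelder_norm \<alpha> f \<le> K"
proof -
  have le: "hoelder_enorm \<alpha> f \<le> ereal K"
    using assms by (simp add: hoelder_enorm_le_iff)
  then show mem: "f \<in> hoelder_space \<alpha>"
    by (auto simp: hoelder_space_def)
  show "hoelder_norm \<alpha> f \<le> K"
    using le hoelder_enorm_eq_norm[OF mem] by simp
qed

lemma hoelder_normD:
  assumes "f \<in> hoelder_space \<alpha>"
  shows "\<bar>f x - f y\<bar> \<le> hoelder_norm \<alpha> f * dist x y powr \<alpha>" and "\<bar>f x\<bar> \<le> hoelder_norm \<alpha> f"
  using hoelder_enorm_le_iff[of \<alpha> f "hoelder_norm \<alpha> f"] hoelder_enorm_eq_norm[OF assms] by auto

text \<open>
  Subhomogeneity already gives homogeneity: for \<open>c \<noteq> 0\<close> the reverse inequality is the same one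
  for the scalar \<open>inverse c\<close> and the function \<open>c f\<close>.
\<close>

lemma normed_fun_spaceI:
  assumes zero: "(\<lambda>x. 0) \<in> E" "N (\<lambda>x. 0) \<le> 0"
    and add: "\<And>f g. f \<in> E \<Longrightarrow> g \<in> E \<Longrightarrow> (\<lambda>x. f x + g x) \<in> E \<and> N (\<lambda>x. f x + g x) \<le> N f + N g"
    and scale: "\<And>f c. f \<in> E \<Longrightarrow> (\<lambda>x. c * f x) \<in> E \<and> N (\<lambda>x. c * f x) \<le> \<bar>c\<bar> * N f"
    and pointwise: "\<And>f x. f \<in> E \<Longrightarrow> \<bar>f x\<bar> \<le> N f"
  shows "normed_fun_space E N"
proof
  fix f c assume f: "f \<in> E"
  show "N (\<lambda>x. c * f x) = \<bar>c\<bar> * N f"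
  proof (cases "c = 0")
    case True
    have "0 \<le> N (\<lambda>x. 0)"
      using pointwise[OF zero(1)] by simp
    then show ?thesis
      using True zero(2) by simp
  next
    case False
    have "N (\<lambda>x. inverse c * (c * f x)) \<le> \<bar>inverse c\<bar> * N (\<lambda>x. c * f x)"
      using scale[of "\<lambda>x. c * f x" "inverse c"] scale[OF f, of c] by blast
    moreover have "(\<lambda>x. inverse c * (c * f x)) = f"
      using False by (simp add: fun_eq_iff)
    ultimately have "N f \<le> N (\<lambda>x. c * f x) / \<bar>c\<bar>"
      by (simp add: divide_inverse mult.commute)
    then have "\<bar>c\<bar> * N f \<le> N (\<lambda>x. c * f x)"
      using False by (simp add: pos_le_divide_eq mult.commute)
    then show ?thesis
      using scale[OF f, of c] by (intro order.antisym) blast+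
  qed
  show "f = (\<lambda>x. 0)" if "N f = 0"
    using pointwise[OF f] that by (simp add: fun_eq_iff)
qed (use assms in auto)

lemma normed_fun_space_hoelder:
  "normed_fun_space (hoelder_space \<alpha> :: ('a::metric_space \<Rightarrow> real) set) (hoelder_norm \<alpha>)"
proof (rule normed_fun_spaceI)
  show "(\<lambda>x::'a. 0) \<in> hoelder_space \<alpha>" and "hoelder_norm \<alpha> (\<lambda>x::'a. 0) \<le> 0"
    using hoelder_normI[of "\<lambda>x::'a. 0" 0 \<alpha>] by simp_all
next
  fix f g :: "'a \<Rightarrow> real" assume fg: "f \<in> hoelder_space \<alpha>" "g \<in> hoelder_space \<alpha>"
  have "\<bar>(f x + g x) - (f y + g y)\<bar> \<le> (hoelder_norm \<alpha> f + hoelder_norm \<alpha> g) * dist x y powr \<alpha>"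
    for x y
    using hoelder_normD(1)[OF fg(1), of x y] hoelder_normD(1)[OF fg(2), of x y]
    unfolding distrib_right by linarith
  moreover have "\<bar>f x + g x\<bar> \<le> hoelder_norm \<alpha> f + hoelder_norm \<alpha> g" for x
    using hoelder_normD(2)[OF fg(1), of x] hoelder_normD(2)[OF fg(2), of x] by linarith
  ultimately show "(\<lambda>x. f x + g x) \<in> hoelder_space \<alpha> \<and>
      hoelder_norm \<alpha> (\<lambda>x. f x + g x) \<le> hoelder_norm \<alpha> f + hoelder_norm \<alpha> g"
    using hoelder_normI[of "\<lambda>x. f x + g x" "hoelder_norm \<alpha> f + hoelder_norm \<alpha> g" \<alpha>] by blast
next
  fix f :: "'a \<Rightarrow> real" and c assume f: "f \<in> hoelder_space \<alpha>"
  have "\<bar>c * f x - c * f y\<bar> \<le> \<bar>c\<bar> * hoelder_norm \<alpha> f * dist x y powr \<alpha>" for x y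
    using mult_left_mono[OF hoelder_normD(1)[OF f, of x y], of "\<bar>c\<bar>"]
    by (simp add: mult.assoc flip: abs_mult right_diff_distrib)
  moreover have "\<bar>c * f x\<bar> \<le> \<bar>c\<bar> * hoelder_norm \<alpha> f" for x
    using hoelder_normD(2)[OF f, of x] by (simp add: abs_mult mult_left_mono)
  ultimately show "(\<lambda>x. c * f x) \<in> hoelder_space \<alpha> \<and>
      hoelder_norm \<alpha> (\<lambda>x. c * f x) \<le> \<bar>c\<bar> * hoelder_norm \<alpha> f"
    using hoelder_normI[of "\<lambda>x. c * f x" "\<bar>c\<bar> * hoelder_norm \<alpha> f" \<alpha>] by blast
qed (rule hoelder_normD(2))

lemma linf_normI:
  assumes "\<And>x. \<bar>f x\<bar> \<le> K"
  shows "f \<in> linf_space" and "linf_norm f \<le> K"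
  using assms by (auto simp: linf_space_def bounded_iff linf_norm_def intro!: cSUP_least)

lemma linf_normD:
  assumes "f \<in> linf_space"
  shows "\<bar>f x\<bar> \<le> linf_norm f"
proof -
  have "bdd_above (range (\<lambda>x. \<bar>f x\<bar>))"
    using assms by (auto simp: linf_space_def bounded_iff bdd_above_def)
  then show ?thesis
    unfolding linf_norm_def by (intro cSUP_upper) auto
qed

lemma normed_fun_space_linf: "normed_fun_space (linf_space :: ('a \<Rightarrow> real) set) linf_norm"
proof (rule normed_fun_spaceI)
  show "(\<lambda>x::'a. 0) \<in> linf_space" and "linf_norm (\<lambda>x::'a. 0) \<le> 0"
    using linf_normI[of "\<lambda>x::'a. 0" 0] by simp_all
next
  fix f g :: "'a \<Rightarrow> real" assume fg: "f \<in> linf_space" "g \<in> linf_space"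
  have "\<bar>f x + g x\<bar> \<le> linf_norm f + linf_norm g" for x
    using linf_normD[OF fg(1), of x] linf_normD[OF fg(2), of x] by linarith
  then show "(\<lambda>x. f x + g x) \<in> linf_space \<and> linf_norm (\<lambda>x. f x + g x) \<le> linf_norm f + linf_norm g"
    using linf_normI[of "\<lambda>x. f x + g x" "linf_norm f + linf_norm g"] by blast
next
  fix f :: "'a \<Rightarrow> real" and c assume f: "f \<in> linf_space"
  have "\<bar>c * f x\<bar> \<le> \<bar>c\<bar> * linf_norm f" for x
    using linf_normD[OF f, of x] by (simp add: abs_mult mult_left_mono)
  then show "(\<lambda>x. c * f x) \<in> linf_space \<and> linf_norm (\<lambda>x. c * f x) \<le> \<bar>c\<bar> * linf_norm f"
    using linf_normI[of "\<lambda>x. c * f x" "\<bar>c\<bar> * linf_norm f"] by blast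
qed (rule linf_normD)

section \<open>Tents over a packing\<close>

definition tent :: "real \<Rightarrow> 'a::metric_space \<Rightarrow> 'a \<Rightarrow> real" where
  "tent r c x = max 0 (1 - dist x c / r)"

lemma tent_bounds: "0 < r \<Longrightarrow> 0 \<le> tent r c x" "0 < r \<Longrightarrow> tent r c x \<le> 1"
  by (auto simp: tent_def)

lemma tent_center: "tent r c c = 1"
  by (simp add: tent_def)

lemma tent_eq_0: "0 < r \<Longrightarrow> r \<le> dist x c \<Longrightarrow> tent r c x = 0"
  by (simp add: tent_def field_simps)

lemma tent_lipschitz:
  assumes "0 < r"
  shows "\<bar>tent r c x - tent r c y\<bar> \<le> dist x y / r"
proof -
  have "\<bar>dist x c - dist y c\<bar> \<le> dist x y"
    using dist_triangle[of x c y] dist_triangle[of y c x] by (simp add: dist_commute abs_le_iff)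
  then have "\<bar>dist x c / r - dist y c / r\<bar> \<le> dist x y / r"
    using assms by (simp add: divide_right_mono flip: diff_divide_distrib abs_div_pos)
  then show ?thesis
    by (auto simp: tent_def)
qed

text \<open>
  A Lipschitz bound and a uniform bound interpolate to a Hoelder bound, since
  \<open>min 1 t \<le> t\<^sup>\<alpha>\<close>.
\<close>

lemma min_one_le_powr:
  fixes t :: real
  assumes "0 \<le> t" and "0 < \<alpha>" and "\<alpha> \<le> 1"
  shows "min 1 t \<le> t powr \<alpha>"
proof (cases "1 \<le> t")
  case True
  then show ?thesis
    using assms ge_one_powr_ge_zero[of t \<alpha>] by simp
next
  case False
  then have "t powr 1 \<le> t powr \<alpha>" if "t \<noteq> 0"
    using assms that by (intro powr_mono') auto
  then show ?thesis
    using assms by (cases "t = 0") auto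
qed

text \<open>
  At most one tent is nonzero at any given point, so a difference of two values of the signed sum
  involves at most two tents; this is what makes the bound independent of \<open>n\<close>.
\<close>

lemma signed_tent_sum_bounds:
  fixes x :: "nat \<Rightarrow> 'a::metric_space"
  assumes pack: "is_packing UNIV \<delta> n x" and \<delta>: "0 < \<delta>" and s: "\<forall>i. \<bar>s i\<bar> = 1"
  defines "f \<equiv> \<lambda>y. \<Sum>i<n. s i * tent (\<delta> / 2) (x i) y"
  shows "\<bar>f y\<bar> \<le> 1" and "\<bar>f y - f z\<bar> \<le> 2 * min 1 (dist y z / (\<delta> / 2))"
proof -
  have disjoint: "i = j"
    if "i < n" "j < n" "tent (\<delta> / 2) (x i) y \<noteq> 0" "tent (\<delta> / 2) (x j) y \<noteq> 0" for i j y
  proof (rule ccontr)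
    assume "i \<noteq> j"
    then have "\<delta> \<le> dist (x i) (x j)"
      using pack that by (simp add: is_packing_def)
    moreover have "dist y (x i) < \<delta> / 2" "dist y (x j) < \<delta> / 2"
      using tent_eq_0[of "\<delta> / 2" y "x i"] tent_eq_0[of "\<delta> / 2" y "x j"] that \<delta> by force+
    ultimately show False
      using dist_triangle[of "x i" "x j" y] by (simp add: dist_commute)
  qed
  have single: "\<exists>A\<subseteq>{..<n}. finite A \<and> card A \<le> 1 \<and> (\<forall>i\<in>{..<n} - A. tent (\<delta> / 2) (x i) y = 0)"
    for y
  proof -
    let ?A = "{i\<in>{..<n}. tent (\<delta> / 2) (x i) y \<noteq> 0}"
    have "card ?A \<le> 1"
      using disjoint by (auto simp: card_le_Suc0_iff_eq)
    then show ?thesis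
      by (intro exI[of _ ?A]) auto
  qed
  show "\<bar>f y\<bar> \<le> 1"
  proof -
    obtain A where A: "A \<subseteq> {..<n}" "finite A" "card A \<le> 1"
      "\<forall>i\<in>{..<n} - A. tent (\<delta> / 2) (x i) y = 0"
      using single by blast
    have "f y = (\<Sum>i\<in>A. s i * tent (\<delta> / 2) (x i) y)"
      unfolding f_def using A by (intro sum.mono_neutral_right) auto
    also have "\<bar>\<dots>\<bar> \<le> (\<Sum>i\<in>A. \<bar>s i * tent (\<delta> / 2) (x i) y\<bar>)"
      by (rule sum_abs)
    also have "\<dots> \<le> (\<Sum>i\<in>A. 1)"
      using \<delta> s by (intro sum_mono) (simp add: abs_mult tent_bounds)
    also have "\<dots> \<le> 1"
      using A(3) by simp
    finally show ?thesis .
  qed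
  show "\<bar>f y - f z\<bar> \<le> 2 * min 1 (dist y z / (\<delta> / 2))"
  proof -
    let ?m = "min 1 (dist y z / (\<delta> / 2))"
    obtain A B where A: "A \<subseteq> {..<n}" "finite A" "card A \<le> 1"
        "\<forall>i\<in>{..<n} - A. tent (\<delta> / 2) (x i) y = 0"
      and B: "B \<subseteq> {..<n}" "finite B" "card B \<le> 1"
        "\<forall>i\<in>{..<n} - B. tent (\<delta> / 2) (x i) z = 0"
      using single by metis
    have "f y - f z = (\<Sum>i<n. s i * (tent (\<delta> / 2) (x i) y - tent (\<delta> / 2) (x i) z))"
      by (simp add: f_def right_diff_distrib sum_subtractf)
    also have "\<dots> = (\<Sum>i\<in>A \<union> B. s i * (tent (\<delta> / 2) (x i) y - tent (\<delta> / 2) (x i) z))"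
      using A B by (intro sum.mono_neutral_right) auto
    also have "\<bar>\<dots>\<bar> \<le> (\<Sum>i\<in>A \<union> B. \<bar>s i * (tent (\<delta> / 2) (x i) y - tent (\<delta> / 2) (x i) z)\<bar>)"
      by (rule sum_abs)
    also have "\<dots> \<le> (\<Sum>i\<in>A \<union> B. ?m)"
    proof (rule sum_mono)
      fix i
      have "\<bar>tent (\<delta> / 2) (x i) y - tent (\<delta> / 2) (x i) z\<bar> \<le> 1"
        using tent_bounds[of "\<delta> / 2" "x i" y] tent_bounds[of "\<delta> / 2" "x i" z] \<delta> by linarith
      then show "\<bar>s i * (tent (\<delta> / 2) (x i) y - tent (\<delta> / 2) (x i) z)\<bar> \<le> ?m"
        using tent_lipschitz[of "\<delta> / 2" "x i" y z] \<delta> s by (simp add: abs_mult)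
    qed
    also have "\<dots> = real (card (A \<union> B)) * ?m"
      by simp
    also have "\<dots> \<le> 2 * ?m"
      using card_Un_le[of A B] A(3) B(3) \<delta> by (intro mult_right_mono) auto
    finally show ?thesis .
  qed
qed

lemma hoelder_signed_tent_sum:
  fixes x :: "nat \<Rightarrow> 'a::metric_space"
  assumes pack: "is_packing UNIV \<delta> n x" and \<delta>: "0 < \<delta>" "\<delta> \<le> 1" and s: "\<forall>i. \<bar>s i\<bar> = 1"
    and \<alpha>: "0 < \<alpha>" "\<alpha> \<le> 1"
  defines "f \<equiv> \<lambda>y. \<Sum>i<n. s i * tent (\<delta> / 2) (x i) y"
  shows "f \<in> hoelder_space \<alpha>" and "hoelder_norm \<alpha> f \<le> 4 * \<delta> powr - \<alpha>"
proof -
  have "\<bar>f y - f z\<bar> \<le> 4 * \<delta> powr - \<alpha> * dist y z powr \<alpha>" for y z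
  proof -
    have "\<bar>f y - f z\<bar> \<le> 2 * (dist y z / (\<delta> / 2)) powr \<alpha>"
      using signed_tent_sum_bounds(2)[OF pack \<delta>(1) s, where y = y and z = z]
        min_one_le_powr[of "dist y z / (\<delta> / 2)" \<alpha>] \<alpha> \<delta> by (simp add: f_def)
    also have "\<dots> = 2 powr \<alpha> * (2 * (\<delta> powr - \<alpha> * dist y z powr \<alpha>))"
      using \<delta> by (simp add: powr_divide powr_mult powr_minus_divide)
    also have "\<dots> \<le> 2 * (2 * (\<delta> powr - \<alpha> * dist y z powr \<alpha>))"
      using \<alpha> powr_mono[of \<alpha> 1 2] by (intro mult_right_mono) auto
    finally show ?thesis
      by simp
  qed
  moreover have "\<bar>f y\<bar> \<le> 4 * \<delta> powr - \<alpha>" for y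
  proof -
    have "1 \<le> \<delta> powr - \<alpha>"
      using powr_mono'[of "- \<alpha>" 0 \<delta>] \<delta> \<alpha> by simp
    then show ?thesis
      using signed_tent_sum_bounds(1)[OF pack \<delta>(1) s, where y = y] by (simp add: f_def)
  qed
  ultimately show "f \<in> hoelder_space \<alpha>" and "hoelder_norm \<alpha> f \<le> 4 * \<delta> powr - \<alpha>"
    using hoelder_normI[of f "4 * \<delta> powr - \<alpha>" \<alpha>] by blast+
qed

text \<open>A single tent is the signed sum over the packing consisting of its centre alone.\<close>

lemma tent_mem_hoelder_space:
  assumes "0 < \<delta>" "\<delta> \<le> 1" "0 < \<alpha>" "\<alpha> \<le> 1"
  shows "tent (\<delta> / 2) c \<in> hoelder_space \<alpha>"
  using hoelder_signed_tent_sum(1)[of \<delta> 1 "\<lambda>_. c" "\<lambda>_. 1" \<alpha>] assms by (simp add: is_packing_def)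

text \<open>
  Some point is at distance more than \<open>\<delta>/2\<close> from \<open>c\<close>, since otherwise the diameter would be at
  most \<open>\<delta>\<close>; the distances from \<open>c\<close> then fill the interval down to \<open>0\<close>.
\<close>

lemma connected_point_at_distance:
  fixes c :: "'a::metric_space"
  assumes conn: "connected (UNIV :: 'a set)" and \<delta>: "0 < \<delta>"
    and diam: "ereal \<delta> < ediameter (UNIV :: 'a set)"
  obtains y where "dist y c = \<delta> / 2"
proof -
  obtain u t :: 'a where "\<delta> < dist u t"
    using diam by (auto simp: ediameter_def less_SUP_iff)
  then have "\<delta> / 2 < dist u c \<or> \<delta> / 2 < dist t c"
    using dist_triangle2[of u t c] by linarith
  then obtain w where w: "\<delta> / 2 < dist w c"
    by blast
  have "connected ((\<lambda>y. dist y c) ` UNIV)"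
    by (intro connected_continuous_image conn continuous_intros)
  moreover have "dist c c \<in> (\<lambda>y. dist y c) ` UNIV" "dist w c \<in> (\<lambda>y. dist y c) ` UNIV"
    by blast+
  ultimately have "\<delta> / 2 \<in> (\<lambda>y. dist y c) ` UNIV"
    by (rule connectedD_interval) (use w \<delta> in auto)
  then show ?thesis
    using that by auto
qed

section \<open>The packing bound\<close>

lemma packing_number_leI:
  assumes "\<And>n x. is_packing X \<delta> n x \<Longrightarrow> real n \<le> K"
  shows "ereal_of_enat (packing_number X \<delta>) \<le> ereal K"
proof -
  have "is_packing X \<delta> 0 x" for x
    by (simp add: is_packing_def)
  then have "{n. \<exists>x. is_packing X \<delta> n x} \<noteq> {}"
    by blast
  then show ?thesis
    using assms by (auto simp: packing_number_def ereal_of_enat_SUP intro!: SUP_least)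
qed

text \<open>
  The hypothesis \<open>lower\<close> is all that the target space of the second embedding contributes.
\<close>

lemma packing_bound:
  fixes H :: "('a::metric_space \<Rightarrow> real) set"
  assumes "rkhs H ip"
    and sub: "hoelder_space \<alpha> \<subseteq> H"
    and upper: "\<And>f. f \<in> hoelder_space \<alpha> \<Longrightarrow> ip_norm ip f \<le> C\<^sub>1 * hoelder_norm \<alpha> f"
    and lower: "\<And>c. \<delta> powr - \<gamma> \<le> C\<^sub>2 * ip_norm ip (tent (\<delta> / 2) (c :: 'a))"
    and C: "0 < C\<^sub>1" "0 < C\<^sub>2" and \<alpha>: "0 < \<alpha>" "\<alpha> \<le> 1" and \<delta>: "0 < \<delta>" "\<delta> \<le> 1"
  shows "ereal_of_enat (packing_number (UNIV :: 'a set) \<delta>)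
    \<le> ereal ((4 * C\<^sub>1 * C\<^sub>2)\<^sup>2 * \<delta> powr (- 2 * (\<alpha> - \<gamma>)))"
proof (rule packing_number_leI)
  interpret rkhs H ip by fact
  interpret normed_fun_space H "ip_norm ip" by (rule normed_fun_space)
  fix n and x :: "nat \<Rightarrow> 'a" assume pack: "is_packing UNIV \<delta> n x"
  let ?v = "\<lambda>i. tent (\<delta> / 2) (x i)"
  have v: "?v i \<in> H" for i
    using tent_mem_hoelder_space[OF \<delta> \<alpha>] sub by blast
  obtain s where s: "\<forall>i. \<bar>s i\<bar> = 1" and mem: "(\<lambda>y. \<Sum>i<n. s i * ?v i y) \<in> H"
    and le: "(\<Sum>i<n. ip (?v i) (?v i)) \<le> ip (\<lambda>y. \<Sum>i<n. s i * ?v i y) (\<lambda>y. \<Sum>i<n. s i * ?v i y)"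
    using exists_signs[of n ?v] v by blast
  define f where "f = (\<lambda>y. \<Sum>i<n. s i * ?v i y)"
  have f: "f \<in> hoelder_space \<alpha>" "hoelder_norm \<alpha> f \<le> 4 * \<delta> powr - \<alpha>"
    unfolding f_def using hoelder_signed_tent_sum[OF pack \<delta> s \<alpha>] by blast+
  have "ip_norm ip f \<le> C\<^sub>1 * hoelder_norm \<alpha> f"
    using upper f(1) by blast
  also have "\<dots> \<le> C\<^sub>1 * (4 * \<delta> powr - \<alpha>)"
    using f(2) C by (intro mult_left_mono) auto
  finally have f_le: "ip_norm ip f \<le> 4 * C\<^sub>1 * \<delta> powr - \<alpha>"
    by simp
  have "real n * (\<delta> powr - \<gamma> / C\<^sub>2)\<^sup>2 = (\<Sum>i<n. (\<delta> powr - \<gamma> / C\<^sub>2)\<^sup>2)"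
    by simp
  also have "\<dots> \<le> (\<Sum>i<n. ip (?v i) (?v i))"
  proof (rule sum_mono)
    fix i
    have "\<delta> powr - \<gamma> / C\<^sub>2 \<le> ip_norm ip (?v i)"
      using lower[of "x i"] C by (simp add: field_simps)
    then have "(\<delta> powr - \<gamma> / C\<^sub>2)\<^sup>2 \<le> (ip_norm ip (?v i))\<^sup>2"
      using C by (intro power_mono) auto
    then show "(\<delta> powr - \<gamma> / C\<^sub>2)\<^sup>2 \<le> ip (?v i) (?v i)"
      using ip_norm_square[OF v] by simp
  qed
  also have "\<dots> \<le> (ip_norm ip f)\<^sup>2"
    using le ip_norm_square[OF mem] by (simp add: f_def)
  also have "\<dots> \<le> (4 * C\<^sub>1 * \<delta> powr - \<alpha>)\<^sup>2"
    using f_le norm_nonneg mem by (intro power_mono) (auto simp: f_def)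
  finally have "real n \<le> (4 * C\<^sub>1 * \<delta> powr - \<alpha>)\<^sup>2 / (\<delta> powr - \<gamma> / C\<^sub>2)\<^sup>2"
    using C \<delta> by (simp add: pos_le_divide_eq)
  also have "\<dots> = (4 * C\<^sub>1 * C\<^sub>2)\<^sup>2 * (\<delta> powr - \<alpha> / \<delta> powr - \<gamma>)\<^sup>2"
    by (simp add: power_mult_distrib power_divide)
  also have "(\<delta> powr - \<alpha> / \<delta> powr - \<gamma>)\<^sup>2 = \<delta> powr (- 2 * (\<alpha> - \<gamma>))"
    using \<delta> by (simp add: powr_power right_diff_distrib flip: powr_diff)
  finally show "real n \<le> (4 * C\<^sub>1 * C\<^sub>2)\<^sup>2 * \<delta> powr (- 2 * (\<alpha> - \<gamma>))" .
qed

theorem theorem12: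
  fixes \<alpha> \<beta> :: real
  assumes "0 < \<beta>" and "\<beta> \<le> \<alpha>" and "\<alpha> \<le> 1"
  shows
    "(connected (UNIV :: 'a::metric_space set) \<and>
      (\<exists>(H :: ('a \<Rightarrow> real) set) ip. rkhs H ip \<and>
         continuously_embedded (hoelder_space \<alpha>) (hoelder_norm \<alpha>) H (ip_norm ip) \<and>
         continuously_embedded H (ip_norm ip) (hoelder_space \<beta>) (hoelder_norm \<beta>))
      \<longrightarrow> (\<exists>C>0. \<forall>\<delta>>0. ereal \<delta> < min 1 (ediameter (UNIV :: 'a set)) \<longrightarrow>
             ereal_of_enat (packing_number (UNIV :: 'a set) \<delta>)
               \<le> ereal (C * \<delta> powr (- 2 * (\<alpha> - \<beta>))))) \<and>
     ((\<exists>(H :: ('a \<Rightarrow> real) set) ip. rkhs H ip \<and>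
         continuously_embedded (hoelder_space \<alpha>) (hoelder_norm \<alpha>) H (ip_norm ip) \<and>
         continuously_embedded H (ip_norm ip) linf_space linf_norm)
      \<longrightarrow> (\<exists>C>0. \<forall>\<delta>>0. ereal \<delta> < min 1 (ediameter (UNIV :: 'a set)) \<longrightarrow>
             ereal_of_enat (packing_number (UNIV :: 'a set) \<delta>)
               \<le> ereal (C * \<delta> powr (- 2 * \<alpha>))))"
proof (intro conjI impI; elim conjE exE)
  have \<alpha>: "0 < \<alpha>" "\<alpha> \<le> 1"
    using assms by auto
  {
    fix H :: "('a \<Rightarrow> real) set" and ip
    assume conn: "connected (UNIV :: 'a set)" and H: "rkhs H ip"
      and emb1: "continuously_embedded (hoelder_space \<alpha>) (hoelder_norm \<alpha>) H (ip_norm ip)"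
      and emb2: "continuously_embedded H (ip_norm ip) (hoelder_space \<beta>) (hoelder_norm \<beta>)"
    obtain C\<^sub>1 where C1: "C\<^sub>1 > 0" "\<forall>f\<in>hoelder_space \<alpha>. ip_norm ip f \<le> C\<^sub>1 * hoelder_norm \<alpha> f"
      using continuously_embedded_bound[OF normed_fun_space_hoelder rkhs.normed_fun_space[OF H] emb1]
      by blast
    obtain C\<^sub>2 where C2: "C\<^sub>2 > 0" "\<forall>f\<in>H. hoelder_norm \<beta> f \<le> C\<^sub>2 * ip_norm ip f"
      using continuously_embedded_bound[OF rkhs.normed_fun_space[OF H] normed_fun_space_hoelder emb2]
      by blast
    have sub: "hoelder_space \<alpha> \<subseteq> H" "H \<subseteq> hoelder_space \<beta>"
      using emb1 emb2 by (auto simp: continuously_embedded_def)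
    have "ereal_of_enat (packing_number (UNIV :: 'a set) \<delta>)
        \<le> ereal ((4 * C\<^sub>1 * C\<^sub>2)\<^sup>2 * \<delta> powr (- 2 * (\<alpha> - \<beta>)))"
      if \<delta>: "0 < \<delta>" and less: "ereal \<delta> < min 1 (ediameter (UNIV :: 'a set))" for \<delta>
    proof (rule packing_bound[OF H sub(1)])
      show "\<delta> \<le> 1"
        using less by simp
      fix c :: 'a
      let ?v = "tent (\<delta> / 2) c"
      have v: "?v \<in> H"
        using tent_mem_hoelder_space[OF \<delta> \<open>\<delta> \<le> 1\<close> \<alpha>] sub by blast
      obtain y where y: "dist y c = \<delta> / 2"
        using connected_point_at_distance[OF conn \<delta>] less by (metis min_less_iff_conj)
      have "1 = \<bar>?v y - ?v c\<bar>"
        using \<delta> y tent_eq_0[of "\<delta> / 2" y c] by (simp add: tent_center)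
      also have "\<dots> \<le> hoelder_norm \<beta> ?v * (\<delta> / 2) powr \<beta>"
        using hoelder_normD(1)[of ?v \<beta> y c] v sub y by auto
      also have "\<dots> \<le> hoelder_norm \<beta> ?v * \<delta> powr \<beta>"
        using \<delta> assms hoelder_normD(2)[of ?v \<beta> c] v sub
        by (intro mult_left_mono powr_mono2) auto
      finally have "\<delta> powr - \<beta> \<le> hoelder_norm \<beta> ?v"
        using \<delta> by (simp add: powr_minus field_simps)
      then show "\<delta> powr - \<beta> \<le> C\<^sub>2 * ip_norm ip ?v"
        using C2(2) v by force
    qed (use C1 C2 \<alpha> \<delta> in auto)
    then show "\<exists>C>0. \<forall>\<delta>>0. ereal \<delta> < min 1 (ediameter (UNIV :: 'a set)) \<longrightarrow>
        ereal_of_enat (packing_number (UNIV :: 'a set) \<delta>) \<le> ereal (C * \<delta> powr (- 2 * (\<alpha> - \<beta>)))"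
      using C1(1) C2(1) by (intro exI[of _ "(4 * C\<^sub>1 * C\<^sub>2)\<^sup>2"]) auto
  next
    fix H :: "('a \<Rightarrow> real) set" and ip
    assume H: "rkhs H ip"
      and emb1: "continuously_embedded (hoelder_space \<alpha>) (hoelder_norm \<alpha>) H (ip_norm ip)"
      and emb2: "continuously_embedded H (ip_norm ip) linf_space linf_norm"
    obtain C\<^sub>1 where C1: "C\<^sub>1 > 0" "\<forall>f\<in>hoelder_space \<alpha>. ip_norm ip f \<le> C\<^sub>1 * hoelder_norm \<alpha> f"
      using continuously_embedded_bound[OF normed_fun_space_hoelder rkhs.normed_fun_space[OF H] emb1]
      by blast
    obtain C\<^sub>2 where C2: "C\<^sub>2 > 0" "\<forall>f\<in>H. linf_norm f \<le> C\<^sub>2 * ip_norm ip f"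
      using continuously_embedded_bound[OF rkhs.normed_fun_space[OF H] normed_fun_space_linf emb2]
      by blast
    have sub: "hoelder_space \<alpha> \<subseteq> H" "H \<subseteq> linf_space"
      using emb1 emb2 by (auto simp: continuously_embedded_def)
    have "ereal_of_enat (packing_number (UNIV :: 'a set) \<delta>)
        \<le> ereal ((4 * C\<^sub>1 * C\<^sub>2)\<^sup>2 * \<delta> powr (- 2 * (\<alpha> - 0)))"
      if \<delta>: "0 < \<delta>" and less: "ereal \<delta> < min 1 (ediameter (UNIV :: 'a set))" for \<delta>
    proof (rule packing_bound[OF H sub(1)])
      show "\<delta> \<le> 1"
        using less by simp
      fix c :: 'a
      let ?v = "tent (\<delta> / 2) c"
      have v: "?v \<in> H"
        using tent_mem_hoelder_space[OF \<delta> \<open>\<delta> \<le> 1\<close> \<alpha>] sub by blast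
      have "1 \<le> linf_norm ?v"
        using linf_normD[of ?v c] v sub by (auto simp: tent_center)
      then show "\<delta> powr - 0 \<le> C\<^sub>2 * ip_norm ip ?v"
        using C2(2) v \<delta> by force
    qed (use C1 C2 \<alpha> \<delta> in auto)
    then show "\<exists>C>0. \<forall>\<delta>>0. ereal \<delta> < min 1 (ediameter (UNIV :: 'a set)) \<longrightarrow>
        ereal_of_enat (packing_number (UNIV :: 'a set) \<delta>) \<le> ereal (C * \<delta> powr (- 2 * \<alpha>))"
      using C1(1) C2(1) by (intro exI[of _ "(4 * C\<^sub>1 * C\<^sub>2)\<^sup>2"]) auto
  }
qed

end
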